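(* Let $M$ be a Riemannian manifold, let $\eta:M\times M\to TM$ satisfy $\eta(u,v)\in T_vM$ for all $u,v\in M$, let $m$ be a positive integer, and let $h:M\to\mathbb{R}$ be a differentiable function. If $h$ is strongly $\eta$-invex of order $m$, then $dh$ is strongly invariant $\eta$-monotone of order $m$.
   Context: Manifolds are $C^\infty$, modelled on a Hilbert space (finite or infinite dimensional), with Riemannian metric $\langle\cdot,\cdot\rangle_p$ and norm $\|\cdot\|_p$ on $T_pM$. The differential $dh$ is identified with the gradient vector field of $h$, so $\langle dh_v,w\rangle_v=dh_v(w)$ for $w\in T_vM$. Strongly $\eta$-invex of order $m$ (for differentiable $h:M\to\mathbb{R}$): there exists $\delta>0$ such that for all $u,v\in M$, $$h(u)\ge h(v)+dh_v(\eta(u,v))+\delta\|\eta(u,v)\|_v^m .$$ Strongly invariant $\eta$-monotone of order $m$ (for a vector field $X$ on $M$): there exists $\delta>0$ such that for all $u,v\in M$, $$\langle X(v),\eta(u,v)\rangle_v+\langle X(u),\eta(v,u)\rangle_u\le-\delta\left\{\|\eta(u,v)\|_v^m+\|\eta(v,u)\|_u^m\right\}.$$ *)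

theory Defs
  imports "HOL-Analysis.Analysis"
begin

section \<open>Smooth maps between normed spaces\<close>

text \<open>An \<open>n\<close>-linear map is represented as a function on lists, of which only the
  values at lists of length \<open>n\<close> are relevant.\<close>

definition bounded_multilinear ::
    "nat \<Rightarrow> ('a::real_normed_vector list \<Rightarrow> 'b::real_normed_vector) \<Rightarrow> bool" where
  "bounded_multilinear n T \<longleftrightarrow>
     (\<forall>vs i. length vs = n \<longrightarrow> i < n \<longrightarrow> linear (\<lambda>v. T (vs[i := v]))) \<and>
     (\<exists>K. \<forall>vs. length vs = n \<longrightarrow> norm (T vs) \<le> K * prod_list (map norm vs))"

text \<open>\<open>D n x\<close> is the \<open>n\<close>-th Frechet derivative of \<open>f\<close> at \<open>x\<close>. The last clause says that
  \<open>D (Suc n) x\<close> is the Frechet derivative at \<open>x\<close> of the map \<open>D n\<close> from \<open>U\<close> to the space of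
  bounded \<open>n\<close>-linear maps with the operator norm; the estimate is uniform in \<open>vs\<close>, which
  matters when \<open>'a\<close> is infinite dimensional.\<close>

definition smooth_map_on ::
    "'a::real_normed_vector set \<Rightarrow> ('a \<Rightarrow> 'b::real_normed_vector) \<Rightarrow> bool" where
  "smooth_map_on U f \<longleftrightarrow>
     (\<exists>D :: nat \<Rightarrow> 'a \<Rightarrow> 'a list \<Rightarrow> 'b.
        (\<forall>x\<in>U. D 0 x [] = f x) \<and>
        (\<forall>n. \<forall>x\<in>U. bounded_multilinear n (D n x)) \<and>
        (\<forall>n. \<forall>x\<in>U. \<forall>\<epsilon>>0. \<exists>\<delta>>0. \<forall>y\<in>U. dist y x < \<delta> \<longrightarrow>
           (\<forall>vs. length vs = n \<longrightarrow>
              norm (D n y vs - D n x vs - D (Suc n) x ((y - x) # vs))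
                \<le> \<epsilon> * norm (y - x) * prod_list (map norm vs))))"

section \<open>Manifolds modelled on a Hilbert space\<close>

text \<open>A chart is a pair of its domain and its coordinate map, of which only the values on
  the domain are relevant. The inverse of a chart \<open>(U, \<phi>)\<close> is \<open>inv_into U \<phi>\<close>.\<close>

type_synonym ('p, 'e) chart = "'p set \<times> ('p \<Rightarrow> 'e)"

locale hilbert_manifold =
  fixes X :: "'p topology"
    and A :: "('p, 'e::{real_inner,complete_space}) chart set"
  assumes Hausdorff: "Hausdorff_space X"
    and chart_domain: "\<And>U \<phi>. (U, \<phi>) \<in> A \<Longrightarrow> openin X U"
    and chart_range: "\<And>U \<phi>. (U, \<phi>) \<in> A \<Longrightarrow> open (\<phi> ` U)"
    and chart_homeomorphism: "\<And>U \<phi>. (U, \<phi>) \<in> A \<Longrightarrow>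
      homeomorphic_map (subtopology X U) (top_of_set (\<phi> ` U)) \<phi>"
    and charts_cover: "topspace X = (\<Union>(U, \<phi>)\<in>A. U)"
    and charts_compatible: "\<And>U \<phi> V \<psi>. (U, \<phi>) \<in> A \<Longrightarrow> (V, \<psi>) \<in> A \<Longrightarrow>
      smooth_map_on (\<phi> ` (U \<inter> V)) (\<psi> \<circ> inv_into U \<phi>)"

section \<open>Tangent vectors and differentials\<close>

text \<open>A tangent vector at \<open>p\<close> is an equivalence class of triples \<open>(p, c, v)\<close>, where \<open>c\<close> is a
  chart around \<open>p\<close> and \<open>v\<close> a vector of the model space: the expression of the tangent vector
  in the chart \<open>c\<close>.\<close>

type_synonym ('p, 'e) tangent = "('p \<times> ('p, 'e) chart \<times> 'e) set"

definition tangent_triples ::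
    "('p, 'e) chart set \<Rightarrow> 'p \<Rightarrow> ('p \<times> ('p, 'e::real_normed_vector) chart \<times> 'e) set" where
  "tangent_triples A p = {(p, (U, \<phi>), v) | U \<phi> v. (U, \<phi>) \<in> A \<and> p \<in> U}"

definition tangent_rel ::
    "('p, 'e) chart set \<Rightarrow> ('p \<times> ('p, 'e::real_normed_vector) chart \<times> 'e) rel" where
  "tangent_rel A = {((p, (U, \<phi>), v), (p, (V, \<psi>), w)) | p U \<phi> v V \<psi> w.
     (U, \<phi>) \<in> A \<and> (V, \<psi>) \<in> A \<and> p \<in> U \<inter> V \<and>
     w = frechet_derivative (\<psi> \<circ> inv_into U \<phi>) (at (\<phi> p)) v}"

definition tangent_space ::
    "('p, 'e) chart set \<Rightarrow> 'p \<Rightarrow> ('p, 'e::real_normed_vector) tangent set" where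
  "tangent_space A p = tangent_triples A p // tangent_rel A"

definition tangent_vector ::
    "('p, 'e) chart set \<Rightarrow> 'p \<Rightarrow> ('p, 'e) chart \<Rightarrow> 'e \<Rightarrow> ('p, 'e::real_normed_vector) tangent" where
  "tangent_vector A p c v = tangent_rel A `` {(p, c, v)}"

definition differentiable_fun ::
    "('p, 'e::real_normed_vector) chart set \<Rightarrow> ('p \<Rightarrow> real) \<Rightarrow> bool" where
  "differentiable_fun A h \<longleftrightarrow>
     (\<forall>(U, \<phi>)\<in>A. \<forall>p\<in>U. (h \<circ> inv_into U \<phi>) differentiable at (\<phi> p))"

definition differential ::
    "('p \<Rightarrow> real) \<Rightarrow> 'p \<Rightarrow> ('p, 'e::real_normed_vector) tangent \<Rightarrow> real" where
  "differential h p \<xi> = (THE r. \<exists>U \<phi> v. (p, (U, \<phi>), v) \<in> \<xi> \<and>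
     r = frechet_derivative (h \<circ> inv_into U \<phi>) (at (\<phi> p)) v)"

section \<open>Riemannian metrics\<close>

text \<open>The metric is bilinear, continuous and smooth through its expression \<open>G\<close> in each chart.
  The last condition contains positive definiteness and, together with the boundedness of
  \<open>G (\<phi> p)\<close>, says that the inner product at \<open>p\<close> induces the topology of the tangent space
  (so each tangent space is a Hilbert space).\<close>

locale riemannian_manifold = hilbert_manifold X A
  for X :: "'p topology"
    and A :: "('p, 'e::{real_inner,complete_space}) chart set" +
  fixes g :: "'p \<Rightarrow> ('p, 'e) tangent \<Rightarrow> ('p, 'e) tangent \<Rightarrow> real"
  assumes metric_symmetric: "\<And>p \<xi> \<zeta>. p \<in> topspace X \<Longrightarrow>
      \<xi> \<in> tangent_space A p \<Longrightarrow> \<zeta> \<in> tangent_space A p \<Longrightarrow> g p \<xi> \<zeta> = g p \<zeta> \<xi>"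
    and metric_smooth: "\<And>U \<phi>. (U, \<phi>) \<in> A \<Longrightarrow>
      \<exists>G :: 'e \<Rightarrow> 'e \<Rightarrow>\<^sub>L 'e \<Rightarrow>\<^sub>L real. smooth_map_on (\<phi> ` U) G \<and>
        (\<forall>p\<in>U. \<forall>v w. g p (tangent_vector A p (U, \<phi>) v) (tangent_vector A p (U, \<phi>) w) =
           blinfun_apply (blinfun_apply (G (\<phi> p)) v) w)"
    and metric_strong: "\<And>U \<phi> p. (U, \<phi>) \<in> A \<Longrightarrow> p \<in> U \<Longrightarrow>
      \<exists>c>0. \<forall>v. c * (norm v)\<^sup>2 \<le>
        g p (tangent_vector A p (U, \<phi>) v) (tangent_vector A p (U, \<phi>) v)"

definition metric_norm ::
    "('p \<Rightarrow> ('p, 'e) tangent \<Rightarrow> ('p, 'e) tangent \<Rightarrow> real) \<Rightarrow> 'p \<Rightarrow> ('p, 'e) tangent \<Rightarrow> real" where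
  "metric_norm g p \<xi> = sqrt (g p \<xi> \<xi>)"

definition gradient ::
    "('p, 'e::real_normed_vector) chart set \<Rightarrow>
     ('p \<Rightarrow> ('p, 'e) tangent \<Rightarrow> ('p, 'e) tangent \<Rightarrow> real) \<Rightarrow>
     ('p \<Rightarrow> real) \<Rightarrow> 'p \<Rightarrow> ('p, 'e) tangent" where
  "gradient A g h p = (THE \<xi>. \<xi> \<in> tangent_space A p \<and>
     (\<forall>\<zeta>\<in>tangent_space A p. g p \<xi> \<zeta> = differential h p \<zeta>))"

definition vector_field ::
    "'p topology \<Rightarrow> ('p, 'e::real_normed_vector) chart set \<Rightarrow> ('p \<Rightarrow> ('p, 'e) tangent) \<Rightarrow> bool" where
  "vector_field X A Y \<longleftrightarrow> (\<forall>p\<in>topspace X. Y p \<in> tangent_space A p)"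

section \<open>Invexity and monotonicity\<close>

definition strongly_invex ::
    "'p topology \<Rightarrow> ('p \<Rightarrow> ('p, 'e) tangent \<Rightarrow> ('p, 'e) tangent \<Rightarrow> real) \<Rightarrow>
     ('p \<Rightarrow> 'p \<Rightarrow> ('p, 'e::real_normed_vector) tangent) \<Rightarrow> nat \<Rightarrow> ('p \<Rightarrow> real) \<Rightarrow> bool" where
  "strongly_invex X g \<eta> m h \<longleftrightarrow>
     (\<exists>\<delta>>0. \<forall>u\<in>topspace X. \<forall>v\<in>topspace X.
        h u \<ge> h v + differential h v (\<eta> u v) + \<delta> * metric_norm g v (\<eta> u v) ^ m)"

definition strongly_invariant_monotone ::
    "'p topology \<Rightarrow> ('p, 'e::real_normed_vector) chart set \<Rightarrow>
     ('p \<Rightarrow> ('p, 'e) tangent \<Rightarrow> ('p, 'e) tangent \<Rightarrow> real) \<Rightarrow>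
     ('p \<Rightarrow> 'p \<Rightarrow> ('p, 'e) tangent) \<Rightarrow> nat \<Rightarrow> ('p \<Rightarrow> ('p, 'e) tangent) \<Rightarrow> bool" where
  "strongly_invariant_monotone X A g \<eta> m Y \<longleftrightarrow>
     vector_field X A Y \<and>
     (\<exists>\<delta>>0. \<forall>u\<in>topspace X. \<forall>v\<in>topspace X.
        g v (Y v) (\<eta> u v) + g u (Y u) (\<eta> v u)
          \<le> - \<delta> * (metric_norm g v (\<eta> u v) ^ m + metric_norm g u (\<eta> v u) ^ m))"

end

theory Submission
  imports Defs
begin

text \<open>Adding the invexity inequalities for \<open>(u, v)\<close> and \<open>(v, u)\<close> cancels the values of \<open>h\<close>
  and gives the monotonicity inequality with the same \<open>\<delta>\<close>, once the differential is represented
  by the gradient. The work lies in showing that the gradient exists: read in a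
  chart, this is the Riesz representation theorem for a coercive symmetric bilinear form \<open>B\<close>,
  obtained by minimizing \<open>B x x - 2 f x\<close>; the chain rule makes the result independent
  of the chart.\<close>

section \<open>Riesz representation\<close>

text \<open>Test the equation with \<open>w = x - y\<close>. This yields uniqueness of the
  gradient.\<close>

lemma coercive_bilinear_unique:
  fixes B :: "'a::real_normed_vector \<Rightarrow> 'a \<Rightarrow> real"
  assumes B: "bounded_bilinear B"
    and c: "c > 0" "\<And>v. c * (norm v)\<^sup>2 \<le> B v v"
    and eq: "\<And>w. B x w = B y w"
  shows "x = y"
proof -
  have "B (x - y) (x - y) = 0"
    by (simp add: bounded_bilinear.diff_left[OF B] eq)
  then have "c * (norm (x - y))\<^sup>2 \<le> 0"
    using c(2)[of "x - y"] by simp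
  with c(1) show ?thesis
    by (simp add: mult_le_0_iff)
qed

text \<open>Direct method: coercivity bounds the functional below and, through a parallelogram
  identity, makes a minimizing sequence Cauchy. Completeness and continuity then give a
  minimizer.\<close>

lemma coercive_symmetric_minimizer:
  fixes B :: "'a::{real_normed_vector,complete_space} \<Rightarrow> 'a \<Rightarrow> real"
  assumes B: "bounded_bilinear B" and sym: "\<And>v w. B v w = B w v"
    and c: "c > 0" "\<And>v. c * (norm v)\<^sup>2 \<le> B v v"
    and f: "bounded_linear f"
  obtains x where "\<And>y. B x x - 2 * f x \<le> B y y - 2 * f y"
proof -
  interpret B: bounded_bilinear B by fact
  interpret f: bounded_linear f by fact
  define J where "J = (\<lambda>x. B x x - 2 * f x)"
  define \<mu> where "\<mu> = Inf (range J)"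
  obtain K where K: "\<And>x. norm (f x) \<le> norm x * K"
    using f.bounded by blast
  have lower: "J x \<ge> - K\<^sup>2 / c" for x
  proof -
    \<comment> \<open>Completing the square in \<open>norm x\<close>.\<close>
    have "0 \<le> (c * norm x - K)\<^sup>2 / c" using c(1) by simp
    also have "\<dots> = c * (norm x)\<^sup>2 - 2 * (norm x * K) + K\<^sup>2 / c"
      using c(1) by (simp add: field_simps power2_eq_square)
    finally have "- K\<^sup>2 / c \<le> c * (norm x)\<^sup>2 - 2 * (norm x * K)" by simp
    also have "\<dots> \<le> J x"
      using c(2)[of x] K[of x] by (simp add: J_def)
    finally show ?thesis .
  qed
  have bdd: "bdd_below (range J)"
    using lower by (rule bdd_belowI2)
  have \<mu>_le: "\<mu> \<le> J x" for x
    unfolding \<mu>_def by (rule cInf_lower[OF _ bdd]) simp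
  have "\<exists>x. J x < \<mu> + 1 / real (Suc n)" for n
    using cInf_lessD[of "range J" "\<mu> + 1 / real (Suc n)"] by (auto simp: \<mu>_def)
  then obtain s where s: "\<And>n. J (s n) < \<mu> + 1 / real (Suc n)"
    by metis
  have parallelogram: "c * (norm (x - y))\<^sup>2 \<le> 2 * (J x - \<mu>) + 2 * (J y - \<mu>)" for x y
  proof -
    \<comment> \<open>The linear parts cancel at the midpoint, and \<open>J\<close> there is at
      least \<mu>. So two points with nearly minimal values must be close.\<close>
    have "J ((1/2) *\<^sub>R (x + y)) = (J x + J y) / 2 - B (x - y) (x - y) / 4"
      by (simp add: J_def B.scaleR_left B.scaleR_right B.add_left B.add_right
          B.diff_left B.diff_right f.add f.scaleR sym[of y x] field_simps)
    with \<mu>_le[of "(1/2) *\<^sub>R (x + y)"] c(2)[of "x - y"] show ?thesis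
      by argo
  qed
  have "Cauchy s"
  proof (rule metric_CauchyI)
    fix e :: real assume e: "e > 0"
    \<comment> \<open>The parallelogram estimate doubles each of the two excesses over \<mu>, so a
      quarter of \<open>c * e\<^sup>2\<close> for each suffices.\<close>
    obtain N where N: "1 / real (Suc N) < c * e\<^sup>2 / 4"
      using nat_approx_posE[of "c * e\<^sup>2 / 4"] e c(1)
      by (metis divide_pos_pos mult_pos_pos zero_less_numeral zero_less_power)
    have le: "J (s n) - \<mu> < c * e\<^sup>2 / 4" if "n \<ge> N" for n
    proof -
      have "1 / real (Suc n) \<le> 1 / real (Suc N)"
        using that by (intro divide_left_mono) auto
      with s[of n] N show ?thesis by linarith
    qed
    have "dist (s i) (s j) < e" if "i \<ge> N" "j \<ge> N" for i j
    proof -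
      have "c * (norm (s i - s j))\<^sup>2 < c * e\<^sup>2"
        using parallelogram[of "s i" "s j"] le[OF that(1)] le[OF that(2)] by argo
      then have "(norm (s i - s j))\<^sup>2 < e\<^sup>2"
        using c(1) by simp
      then show ?thesis
        using e by (simp add: dist_norm power2_less_imp_less)
    qed
    then show "\<exists>M. \<forall>i\<ge>M. \<forall>j\<ge>M. dist (s i) (s j) < e"
      by blast
  qed
  then obtain x where x: "s \<longlonglongrightarrow> x"
    using Cauchy_convergent convergent_def by blast
  have "(\<lambda>n. J (s n)) \<longlonglongrightarrow> J x"
    unfolding J_def by (intro tendsto_intros B.tendsto f.tendsto x)
  moreover have "(\<lambda>n. \<mu> + 1 / real (Suc n)) \<longlonglongrightarrow> \<mu> + 0"
    using LIMSEQ_inverse_real_of_nat by (intro tendsto_intros) (simp add: inverse_eq_divide)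
  ultimately have "J x \<le> \<mu> + 0"
    by (rule LIMSEQ_le) (use s less_imp_le in blast)
  with \<mu>_le show thesis
    by (intro that[of x]) (simp add: J_def, metis order_trans)
qed

text \<open>The first variation of \<open>B y y - 2 * f y\<close> vanishes at a minimizer, and this
  is the required equation.\<close>

lemma coercive_symmetric_representation:
  fixes B :: "'a::{real_normed_vector,complete_space} \<Rightarrow> 'a \<Rightarrow> real"
  assumes B: "bounded_bilinear B" and sym: "\<And>v w. B v w = B w v"
    and c: "c > 0" "\<And>v. c * (norm v)\<^sup>2 \<le> B v v"
    and f: "bounded_linear f"
  obtains x where "\<And>w. B x w = f w"
proof -
  interpret B: bounded_bilinear B by fact
  interpret f: bounded_linear f by fact
  obtain x where x: "\<And>y. B x x - 2 * f x \<le> B y y - 2 * f y"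
    using coercive_symmetric_minimizer[OF assms] by blast
  have "B x w = f w" for w
  proof -
    define a where "a = B x w - f w"
    define b where "b = B w w"
    \<comment> \<open>The right-hand side is the increase of the functional from \<open>x\<close> to
      \<open>x + t *\<^sub>R w\<close>; symmetry merges the two mixed terms.\<close>
    have pos: "0 \<le> 2 * t * a + t\<^sup>2 * b" for t
      using x[of "x + t *\<^sub>R w"] sym[of w x]
      by (simp add: a_def b_def B.add_left B.add_right B.scaleR_left B.scaleR_right f.add f.scaleR
          power2_eq_square algebra_simps)
    have "b \<ge> 0"
      using c(2)[of w] c(1) by (auto simp: b_def intro: order_trans[rotated])
    \<comment> \<open>The quadratic in \<open>t\<close> has its minimum at \<open>- a / b\<close>;
      the denominator \<open>b + 1\<close> avoids a separate case \<open>b = 0\<close> and still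
      gives a negative value unless \<open>a = 0\<close>.\<close>
    then have "2 * (- a / (b + 1)) * a + (- a / (b + 1))\<^sup>2 * b = - (a\<^sup>2 * ((b + 2) / (b + 1)\<^sup>2))"
      by (simp add: divide_simps) algebra
    with pos[of "- a / (b + 1)"] have "a\<^sup>2 * ((b + 2) / (b + 1)\<^sup>2) \<le> 0"
      by linarith
    moreover have "(b + 2) / (b + 1)\<^sup>2 > 0"
      using \<open>b \<ge> 0\<close> by simp
    ultimately have "a = 0"
      by (metis mult_pos_pos not_le zero_less_power2)
    then show ?thesis by (simp add: a_def)
  qed
  then show thesis by (rule that)
qed

section \<open>Smooth maps and changes of charts\<close>

text \<open>The estimate in \<open>smooth_map_on\<close> for \<open>n = 0\<close> is Frechet
  differentiability with derivative \<open>D 1 x\<close>; the product over the empty list is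
  1.\<close>

lemma smooth_map_on_imp_differentiable:
  assumes f: "smooth_map_on S f" and "open S" and x: "x \<in> S"
  shows "f differentiable at x"
proof -
  obtain D where D0: "\<forall>x\<in>S. D 0 x [] = f x"
    and ml: "\<forall>n. \<forall>x\<in>S. bounded_multilinear n (D n x)"
    and D: "\<forall>n. \<forall>x\<in>S. \<forall>\<epsilon>>0. \<exists>\<delta>>0. \<forall>y\<in>S. dist y x < \<delta> \<longrightarrow>
           (\<forall>vs. length vs = n \<longrightarrow>
              norm (D n y vs - D n x vs - D (Suc n) x ((y - x) # vs))
                \<le> \<epsilon> * norm (y - x) * prod_list (map norm vs))"
    using f unfolding smooth_map_on_def by (elim exE conjE)
  have ml1: "bounded_multilinear 1 (D 1 x)"
    using ml x by blast
  define T where "T = (\<lambda>v. D 1 x [v])"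
  have "linear (\<lambda>v. D 1 x (vs[i := v]))" if "length vs = 1" "i < 1" for vs i
    using ml1 that unfolding bounded_multilinear_def by blast
  \<comment> \<open>Updating the only entry of \<open>[0]\<close> turns linearity in a slot into
    linearity of \<open>T\<close>.\<close>
  from this[of "[0]" 0] have "linear T"
    by (simp add: T_def)
  moreover obtain K where K: "\<And>vs. length vs = 1 \<Longrightarrow> norm (D 1 x vs) \<le> K * prod_list (map norm vs)"
    using ml1 unfolding bounded_multilinear_def by blast
  have "norm (T v) \<le> norm v * K" for v
    using K[of "[v]"] by (simp add: T_def mult.commute)
  ultimately have "bounded_linear T"
    by (intro bounded_linear.intro) (auto simp: bounded_linear_axioms_def)
  moreover have "\<exists>d>0. \<forall>y\<in>S. norm (y - x) < d \<longrightarrow>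
      norm (f y - f x - T (y - x)) \<le> e * norm (y - x)" if "e > 0" for e
    using D[rule_format, OF x that, of 0] D0 x by (auto simp: T_def dist_norm)
  ultimately have "(f has_derivative T) (at x within S)"
    unfolding has_derivative_within_alt by blast
  then show ?thesis
    using at_within_open[OF x \<open>open S\<close>] differentiable_def by metis
qed

text \<open>The class of a triple is a family with exactly one coordinate vector for each chart
  around \<open>p\<close>.\<close>

lemma tangent_vector_eq:
  assumes "(U, \<phi>) \<in> A" "p \<in> U"
  shows "tangent_vector A p (U, \<phi>) v =
    {(p, (V, \<psi>), frechet_derivative (\<psi> \<circ> inv_into U \<phi>) (at (\<phi> p)) v) | V \<psi>. (V, \<psi>) \<in> A \<and> p \<in> V}"
  using assms unfolding tangent_vector_def tangent_rel_def by auto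

section \<open>Chain rule and tangent vectors under changes of charts\<close>

context hilbert_manifold
begin

lemma chart_inj: "(U, \<phi>) \<in> A \<Longrightarrow> inj_on \<phi> U"
  using homeomorphic_imp_injective_map[OF chart_homeomorphism] chart_domain openin_subset
  by (metis topspace_subtopology_subset)

lemma chart_image_open:
  assumes "(U, \<phi>) \<in> A" "(V, \<psi>) \<in> A"
  shows "open (\<phi> ` (U \<inter> V))"
proof -
  have "openin (subtopology X U) (U \<inter> V)"
    using chart_domain assms by (metis openin_subtopology_Int2)
  then have "openin (top_of_set (\<phi> ` U)) (\<phi> ` (U \<inter> V))"
    using homeomorphic_map_openness_eq[OF chart_homeomorphism[OF assms(1)]] by blast
  then show ?thesis
    using chart_range[OF assms(1)] openin_open_trans by blast
qed

text \<open>Chain rule through the transition map. The map \<open>F\<close> is arbitrary so that it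
  can be a third chart, for tangent vectors, or the function \<open>h\<close>, for its
  differential.\<close>

lemma has_derivative_chart_change:
  assumes c: "(U, \<phi>) \<in> A" "(V, \<psi>) \<in> A" and p: "p \<in> U" "p \<in> V"
    and F: "(F \<circ> inv_into V \<psi>) differentiable at (\<psi> p)"
  shows "(F \<circ> inv_into U \<phi> has_derivative
    frechet_derivative (F \<circ> inv_into V \<psi>) (at (\<psi> p)) \<circ>
    frechet_derivative (\<psi> \<circ> inv_into U \<phi>) (at (\<phi> p))) (at (\<phi> p))"
proof -
  let ?S = "\<phi> ` (U \<inter> V)"
  have inv: "inv_into U \<phi> (\<phi> q) = q" if "q \<in> U" for q
    using that chart_inj[OF c(1)] by simp
  have inv': "inv_into V \<psi> (\<psi> q) = q" if "q \<in> V" for q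
    using that chart_inj[OF c(2)] by simp
  have S: "open ?S" "\<phi> p \<in> ?S"
    using chart_image_open[OF c] p by auto
  have "(\<psi> \<circ> inv_into U \<phi>) differentiable at (\<phi> p)"
    using smooth_map_on_imp_differentiable[OF charts_compatible[OF c] S] .
  then have "(\<psi> \<circ> inv_into U \<phi> has_derivative
      frechet_derivative (\<psi> \<circ> inv_into U \<phi>) (at (\<phi> p))) (at (\<phi> p))"
    by (simp add: frechet_derivative_works)
  moreover have "(F \<circ> inv_into V \<psi> has_derivative
      frechet_derivative (F \<circ> inv_into V \<psi>) (at (\<psi> p))) (at ((\<psi> \<circ> inv_into U \<phi>) (\<phi> p)))"
    using F p by (simp add: inv frechet_derivative_works)
  ultimately have "((F \<circ> inv_into V \<psi>) \<circ> (\<psi> \<circ> inv_into U \<phi>) has_derivative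
      frechet_derivative (F \<circ> inv_into V \<psi>) (at (\<psi> p)) \<circ>
      frechet_derivative (\<psi> \<circ> inv_into U \<phi>) (at (\<phi> p))) (at (\<phi> p))"
    by (rule diff_chain_at)
  \<comment> \<open>The two maps need agree only over the chart overlap, whose image is an open
    neighbourhood of the base point; this determines the derivative.\<close>
  moreover have "((F \<circ> inv_into V \<psi>) \<circ> (\<psi> \<circ> inv_into U \<phi>)) y = (F \<circ> inv_into U \<phi>) y"
    if y: "y \<in> ?S" for y
  proof -
    obtain q where "q \<in> U" "q \<in> V" "y = \<phi> q" using y by blast
    then show ?thesis by (simp add: inv inv')
  qed
  ultimately show ?thesis
    by (rule has_derivative_transform_within_open[OF _ S])
qed

lemma frechet_derivative_chart_change:
  assumes "(U, \<phi>) \<in> A" "(V, \<psi>) \<in> A" "p \<in> U" "p \<in> V"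
    and "(F \<circ> inv_into V \<psi>) differentiable at (\<psi> p)"
  shows "frechet_derivative (F \<circ> inv_into U \<phi>) (at (\<phi> p)) v =
    frechet_derivative (F \<circ> inv_into V \<psi>) (at (\<psi> p))
      (frechet_derivative (\<psi> \<circ> inv_into U \<phi>) (at (\<phi> p)) v)"
  using fun_cong[OF frechet_derivative_at[OF has_derivative_chart_change[OF assms]], of v]
  by (simp only: comp_apply)

text \<open>The derivatives of the transition maps satisfy the cocycle identity, so both families
  have the same member in every chart.\<close>

lemma tangent_vector_chart_change:
  assumes "(U, \<phi>) \<in> A" "(V, \<psi>) \<in> A" "p \<in> U" "p \<in> V"
  shows "tangent_vector A p (U, \<phi>) v =
    tangent_vector A p (V, \<psi>) (frechet_derivative (\<psi> \<circ> inv_into U \<phi>) (at (\<phi> p)) v)"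
proof -
  have eq: "frechet_derivative (\<theta> \<circ> inv_into U \<phi>) (at (\<phi> p)) v =
    frechet_derivative (\<theta> \<circ> inv_into V \<psi>) (at (\<psi> p))
      (frechet_derivative (\<psi> \<circ> inv_into U \<phi>) (at (\<phi> p)) v)"
    if "(W, \<theta>) \<in> A" "p \<in> W" for W \<theta>
  proof (rule frechet_derivative_chart_change[OF assms])
    show "(\<theta> \<circ> inv_into V \<psi>) differentiable at (\<psi> p)"
      by (rule smooth_map_on_imp_differentiable[OF charts_compatible[OF assms(2) that(1)]
            chart_image_open[OF assms(2) that(1)]]) (use that(2) assms(4) in blast)
  qed
  show ?thesis
    unfolding tangent_vector_eq[OF assms(1,3)] tangent_vector_eq[OF assms(2,4)]
    by (intro Collect_cong ex_cong1) (auto simp: eq[symmetric])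
qed

text \<open>A single chart around \<open>p\<close> parametrizes all tangent vectors, since a
  representative in any other chart can be moved to it.\<close>

lemma tangent_space_eq:
  assumes c: "(U, \<phi>) \<in> A" "p \<in> U"
  shows "tangent_space A p = range (tangent_vector A p (U, \<phi>))"
proof
  show "range (tangent_vector A p (U, \<phi>)) \<subseteq> tangent_space A p"
    using c unfolding tangent_space_def tangent_vector_def tangent_triples_def
    by (auto intro!: quotientI)
  show "tangent_space A p \<subseteq> range (tangent_vector A p (U, \<phi>))"
  proof
    fix \<xi> assume "\<xi> \<in> tangent_space A p"
    then obtain V \<psi> v where "(V, \<psi>) \<in> A" "p \<in> V" "\<xi> = tangent_vector A p (V, \<psi>) v"
      unfolding tangent_space_def tangent_vector_def tangent_triples_def quotient_def by blast
    then show "\<xi> \<in> range (tangent_vector A p (U, \<phi>))"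
      using tangent_vector_chart_change[of V \<psi> U \<phi> p v] c by blast
  qed
qed

text \<open>By the chain rule all representatives of a tangent vector give the same value, so the
  definite description in \<open>differential\<close> is meaningful.\<close>

lemma differential_tangent_vector:
  assumes h: "differentiable_fun A h" and c: "(U, \<phi>) \<in> A" "p \<in> U"
  shows "differential h p (tangent_vector A p (U, \<phi>) v) =
    frechet_derivative (h \<circ> inv_into U \<phi>) (at (\<phi> p)) v"
proof -
  have eq: "frechet_derivative (h \<circ> inv_into V \<psi>) (at (\<psi> p))
      (frechet_derivative (\<psi> \<circ> inv_into U \<phi>) (at (\<phi> p)) v) =
      frechet_derivative (h \<circ> inv_into U \<phi>) (at (\<phi> p)) v"
    if "(V, \<psi>) \<in> A" "p \<in> V" for V \<psi>
    using frechet_derivative_chart_change[of U \<phi> V \<psi> p h v] h c that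
    unfolding differentiable_fun_def by fastforce
  show ?thesis
    unfolding differential_def tangent_vector_eq[OF c]
    by (rule the_equality) (use c eq in \<open>auto, metis\<close>)
qed

end

section \<open>Existence and uniqueness of the gradient\<close>

context riemannian_manifold
begin

lemma gradient_exists_unique:
  assumes h: "differentiable_fun A h" and p: "p \<in> topspace X"
  shows "\<exists>!\<xi>. \<xi> \<in> tangent_space A p \<and> (\<forall>\<zeta>\<in>tangent_space A p. g p \<xi> \<zeta> = differential h p \<zeta>)"
proof -
  obtain U \<phi> where c: "(U, \<phi>) \<in> A" "p \<in> U"
    using p charts_cover by auto
  let ?t = "tangent_vector A p (U, \<phi>)"
  let ?f = "frechet_derivative (h \<circ> inv_into U \<phi>) (at (\<phi> p))"
  define B where "B = (\<lambda>v w. g p (?t v) (?t w))"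
  obtain G :: "'e \<Rightarrow> 'e \<Rightarrow>\<^sub>L 'e \<Rightarrow>\<^sub>L real" where "\<And>v w. B v w = G (\<phi> p) v w"
    using metric_smooth[OF c(1)] c(2) unfolding B_def by blast
  then have "B = (\<lambda>v w. G (\<phi> p) v w)" by blast
  \<comment> \<open>Evaluation of bounded linear maps is bounded bilinear, and its first argument
    depends on \<open>v\<close> through the bounded linear map \<open>G (\<phi> p)\<close>.\<close>
  moreover have "bounded_bilinear (\<lambda>v w. G (\<phi> p) v w)"
    using bounded_bilinear.comp[OF bounded_bilinear_blinfun_apply
        blinfun.bounded_linear_right bounded_linear_ident] .
  ultimately have B: "bounded_bilinear B" by simp
  have sym: "B v w = B w v" for v w
    unfolding B_def using metric_symmetric[OF p] tangent_space_eq[OF c] by blast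
  obtain k where k: "k > 0" "\<And>v. k * (norm v)\<^sup>2 \<le> B v v"
    using metric_strong[OF c] unfolding B_def by blast
  have "bounded_linear ?f"
    using h c unfolding differentiable_fun_def
    by (metis (no_types, lifting) case_prodD frechet_derivative_works has_derivative_bounded_linear)
  from coercive_symmetric_representation[OF B sym k this]
  obtain x where x: "\<And>w. B x w = ?f w" by blast
  \<comment> \<open>Every tangent vector at \<open>p\<close> has the form \<open>?t w\<close>, so
    the gradient condition becomes the Riesz equation in the model space.\<close>
  have gradient_iff: "(\<forall>\<zeta>\<in>tangent_space A p. g p (?t y) \<zeta> = differential h p \<zeta>) \<longleftrightarrow>
      (\<forall>w. B y w = ?f w)" for y
    by (simp add: tangent_space_eq[OF c] B_def differential_tangent_vector[OF h c])
  show ?thesis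
  proof (rule ex1I[of _ "?t x"])
    show "?t x \<in> tangent_space A p \<and>
        (\<forall>\<zeta>\<in>tangent_space A p. g p (?t x) \<zeta> = differential h p \<zeta>)"
      unfolding gradient_iff using x by (simp add: tangent_space_eq[OF c])
  next
    fix \<xi> assume \<xi>: "\<xi> \<in> tangent_space A p \<and>
        (\<forall>\<zeta>\<in>tangent_space A p. g p \<xi> \<zeta> = differential h p \<zeta>)"
    then obtain y where y: "\<xi> = ?t y"
      using tangent_space_eq[OF c] by blast
    with \<xi> have "B y w = B x w" for w
      using gradient_iff x by simp
    then show "\<xi> = ?t x"
      using coercive_bilinear_unique[OF B k] y by blast
  qed
qed

lemma
  assumes "differentiable_fun A h" "p \<in> topspace X"
  shows gradient_in_tangent_space: "gradient A g h p \<in> tangent_space A p"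
    and metric_gradient: "\<zeta> \<in> tangent_space A p \<Longrightarrow> g p (gradient A g h p) \<zeta> = differential h p \<zeta>"
  using theI'[OF gradient_exists_unique[OF assms]] unfolding gradient_def by auto

end

section \<open>From invexity to monotonicity of the gradient\<close>

theorem theorem5:
  fixes X :: "'p topology"
    and A :: "('p, 'e::{real_inner,complete_space}) chart set"
    and g :: "'p \<Rightarrow> ('p, 'e) tangent \<Rightarrow> ('p, 'e) tangent \<Rightarrow> real"
    and \<eta> :: "'p \<Rightarrow> 'p \<Rightarrow> ('p, 'e) tangent"
    and m :: nat
    and h :: "'p \<Rightarrow> real"
  assumes "riemannian_manifold X A g"
    and "\<And>u v. u \<in> topspace X \<Longrightarrow> v \<in> topspace X \<Longrightarrow> \<eta> u v \<in> tangent_space A v"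
    and "m > 0"
    and "differentiable_fun A h"
    and "strongly_invex X g \<eta> m h"
  shows "strongly_invariant_monotone X A g \<eta> m (gradient A g h)"
proof -
  interpret riemannian_manifold X A g by fact
  obtain \<delta> where \<delta>: "\<delta> > 0" and invex: "\<And>u v. u \<in> topspace X \<Longrightarrow> v \<in> topspace X \<Longrightarrow>
      h u \<ge> h v + differential h v (\<eta> u v) + \<delta> * metric_norm g v (\<eta> u v) ^ m"
    using assms(5) unfolding strongly_invex_def by blast
  have "g v (gradient A g h v) (\<eta> u v) + g u (gradient A g h u) (\<eta> v u)
      \<le> - \<delta> * (metric_norm g v (\<eta> u v) ^ m + metric_norm g u (\<eta> v u) ^ m)"
    if "u \<in> topspace X" "v \<in> topspace X" for u v
    \<comment> \<open>The second instance exchanges \<open>u\<close> and \<open>v\<close>. Tangency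
      of \<open>\<eta> u v\<close> at \<open>v\<close> and of \<open>\<eta> v u\<close> at
      \<open>u\<close> allows both differentials to be written with the gradient.\<close>
    using invex[OF that] invex[OF that(2) that(1)] that
    by (simp add: metric_gradient assms(2,4) distrib_left)
  then show ?thesis
    using \<delta> gradient_in_tangent_space[OF assms(4)]
    unfolding strongly_invariant_monotone_def vector_field_def by blast
qed

end
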